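(* For any $1<t<3/2$ and any $1\le p,q\le+\infty$ with $\frac1q-\frac1p<2t-2$, the operator $$K_{2t}f(z):=\int_{\mathbb D}\frac{f(w)}{(1-z\overline w)^{2t}}\,dA(w)$$ is not bounded from $L^p(\mathbb D)$ to $L^{q,\infty}(\mathbb D)$.
   Context: $\mathbb D$ is the open unit disc in $\mathbb C$, $dA$ is normalized area measure on $\mathbb D$, $|E|$ is the $dA$-measure of $E$, and $L^p(\mathbb D)$ is taken with respect to $dA$. For $q<\infty$, $\|f\|_{L^{q,\infty}(\mathbb D)}:=\sup_{\lambda>0}\lambda|\{z\in\mathbb D:|f(z)|>\lambda\}|^{1/q}$; for $q=\infty$, $L^{\infty,\infty}(\mathbb D)=L^\infty(\mathbb D)$. Conventions: $1/\infty=0$. "Bounded" means there is $C$ with $\|K_{2t}f\|_{L^{q,\infty}(\mathbb D)}\le C\|f\|_{L^p(\mathbb D)}$ for all $f\in L^p(\mathbb D)$. *)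

theory Defs
  imports "HOL-Probability.Essential_Supremum"
begin

abbreviation unit_disc :: "complex set"
  where "unit_disc \<equiv> ball 0 1"

text \<open>Exponents range over \<^typ>\<open>ereal\<close>, where \<open>1 / \<infinity> = 0\<close>. Functions on the disc are total
  functions on \<^typ>\<open>complex\<close> whose values off the disc, the space of this measure, are ignored.\<close>

definition area_measure :: "complex measure"
  where "area_measure = uniform_measure (lebesgue_on unit_disc) unit_disc"

definition Lp_norm :: "ereal \<Rightarrow> (complex \<Rightarrow> complex) \<Rightarrow> ennreal"
  where "Lp_norm p f =
    (if p = \<infinity> then esssup area_measure (\<lambda>z. ennreal (norm (f z)))
     else let I = (\<integral>\<^sup>+ z. ennreal (norm (f z) powr real_of_ereal p) \<partial>area_measure)
          in if I = \<infinity> then \<infinity> else ennreal (enn2real I powr (1 / real_of_ereal p)))"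

definition Lp :: "ereal \<Rightarrow> (complex \<Rightarrow> complex) set"
  where "Lp p = {f \<in> borel_measurable area_measure. Lp_norm p f < \<infinity>}"

definition weak_Lp_norm :: "ereal \<Rightarrow> (complex \<Rightarrow> complex) \<Rightarrow> ennreal"
  where "weak_Lp_norm q f =
    (if q = \<infinity> then Lp_norm \<infinity> f
     else SUP s\<in>{0::real<..}.
       ennreal (s * measure area_measure {z \<in> unit_disc. norm (f z) > s} powr (1 / real_of_ereal q)))"

text \<open>For \<open>z, w\<close> in the disc, \<open>1 - z * cnj w\<close> has positive real part, so \<open>powr\<close> is the
  branch of the power that is continuous there and equals 1 at \<open>z = 0\<close>.\<close>

definition bergman_op :: "real \<Rightarrow> (complex \<Rightarrow> complex) \<Rightarrow> complex \<Rightarrow> complex"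
  where "bergman_op \<alpha> f z =
    (\<integral>w. f w / (1 - z * cnj w) powr (complex_of_real \<alpha>) \<partial>area_measure)"

definition bounded_Lp_weak_Lq ::
    "ereal \<Rightarrow> ereal \<Rightarrow> ((complex \<Rightarrow> complex) \<Rightarrow> complex \<Rightarrow> complex) \<Rightarrow> bool"
  where "bounded_Lp_weak_Lq p q T \<longleftrightarrow>
    (\<exists>C::real. \<forall>f\<in>Lp p. weak_Lp_norm q (T f) \<le> ennreal C * Lp_norm p f)"

end

theory Submission
  imports Defs
begin

text \<open>
  Write \<open>\<alpha> = 2 * t\<close>. The kernel has the expansion
  \<open>(1 - z * cnj w) powr - \<alpha> = (\<Sum>k. a k * (z * cnj w) ^ k)\<close> with \<open>\<bar>a k\<bar>\<close> of exact order
  \<open>k powr (\<alpha> - 1)\<close>. As monomials with different exponents are orthogonal on rotation invariant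
  sets, the operator maps \<open>w ^ n\<close>, cut off to an annulus \<open>r < \<bar>w\<bar> < 1\<close>, to the multiple of \<open>z ^ n\<close>
  with factor \<open>a n\<close> times the integral of \<open>\<bar>w\<bar> ^ (2 * n)\<close> over the annulus
  (\<open>bergman_op_annulus_monomial\<close>).

  Choose the annulus with normalized area \<open>m = 1 / (2 * n)\<close>. Then \<open>\<bar>w\<bar> ^ n\<close> is bounded below on it, so
  the test function has \<open>L\<^sup>p\<close> norm at most \<open>m powr (1 / p)\<close>, and its image is of size at least of
  order \<open>\<bar>a n\<bar> * m\<close> on the annulus, hence has weak \<open>L\<^sup>q\<close> norm at least of order
  \<open>\<bar>a n\<bar> * m * m powr (1 / q)\<close>. A bound for the operator would therefore force
  \<open>\<bar>a n\<bar> \<le> const * n powr (1 + 1 / q - 1 / p)\<close> (\<open>norm_gbinomial_le_of_bounded\<close>). This contradicts the growth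
  of \<open>a n\<close> (\<open>norm_gbinomial_asymptotic\<close>) as soon as \<open>1 / q - 1 / p < \<alpha> - 2\<close>.

  Orthogonality rests on the rotation invariance of planar Lebesgue measure
  (\<open>distr_lborel_rotation\<close>). The cut-off replaces the exact \<open>L\<^sup>p\<close> norm of a monomial by a bound in
  terms of the measure of one set, which treats finite and infinite exponents alike.
\<close>

section \<open>Rotation invariance of area in the complex plane\<close>

text \<open>Invariance of Lebesgue measure under orthogonal maps is a theorem about \<open>real ^ 'n\<close>; these two
  inverse isometries carry it over to \<^typ>\<open>complex\<close>.\<close>

definition complex_of_vec :: "real ^ 2 \<Rightarrow> complex"
  where "complex_of_vec v = Complex (v $ 1) (v $ 2)"

definition vec_of_complex :: "complex \<Rightarrow> real ^ 2"
  where "vec_of_complex z = vector [Re z, Im z]"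

lemma vec_complex_inverse [simp]:
  "complex_of_vec (vec_of_complex z) = z" "vec_of_complex (complex_of_vec v) = v"
  by (simp_all add: complex_of_vec_def vec_of_complex_def vec_eq_iff forall_2 complex_eq_iff)

lemma norm_vec_of_complex: "norm (vec_of_complex z) = norm z"
  by (simp add: norm_vec_def L2_set_def sum_2 vec_of_complex_def cmod_def)

lemma norm_complex_of_vec: "norm (complex_of_vec v) = norm v"
  by (metis norm_vec_of_complex vec_complex_inverse(2))

lemma measurable_complex_of_vec [measurable]: "complex_of_vec \<in> borel_measurable borel"
proof -
  have "continuous_on UNIV complex_of_vec"
    unfolding complex_of_vec_def by (intro continuous_intros)
  then show ?thesis
    by (simp add: borel_measurable_continuous_onI)
qed

lemma lborel_complex_eq_distr: "(lborel :: complex measure) = distr lborel borel complex_of_vec"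
proof (rule lborel_eqI)
  fix l u :: complex
  assume le: "\<And>b. b \<in> Basis \<Longrightarrow> l \<bullet> b \<le> u \<bullet> b"
  have preimage: "complex_of_vec -` box l u = box (vec_of_complex l) (vec_of_complex u)"
    by (auto simp: box_def Basis_complex_def complex_of_vec_def vec_of_complex_def Basis_vec_def
      inner_axis forall_2)
  have le': "vec_of_complex l $ i \<le> vec_of_complex u $ i" for i
    using le[of 1] le[of \<i>] exhaust_2[of i] by (auto simp: Basis_complex_def vec_of_complex_def)
  have "emeasure lborel (complex_of_vec -` box l u)
      = ennreal (\<Prod>b\<in>Basis. (vec_of_complex u - vec_of_complex l) \<bullet> b)"
    unfolding preimage
    by (rule emeasure_lborel_box)
      (auto simp: Basis_vec_def inner_axis le')
  also have "(\<Prod>b\<in>Basis. (vec_of_complex u - vec_of_complex l) \<bullet> b) = (Re u - Re l) * (Im u - Im l)"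
  proof -
    have B: "(Basis :: (real^2) set) = {axis 1 1, axis 2 1}"
      by (auto simp: Basis_vec_def UNIV_2)
    have "axis 1 1 \<noteq> (axis 2 1 :: real^2)"
      by (simp add: axis_eq_axis)
    then show ?thesis
      by (simp add: B inner_axis vec_of_complex_def)
  qed
  also have "\<dots> = (\<Prod>b\<in>Basis. (u - l) \<bullet> b)"
    by (simp add: Basis_complex_def)
  finally show "emeasure (distr lborel borel complex_of_vec) (box l u) = ennreal (prod ((\<bullet>) (u - l)) Basis)"
    by (simp add: emeasure_distr)
qed simp

text \<open>A measure that gives every box its volume is Lebesgue measure, and the preimage of a box under
  multiplication by \<open>u\<close> is, in real coordinates, the image of that box under the orthogonal map
  coming from multiplication by \<open>cnj u\<close>.\<close>

lemma distr_lborel_rotation: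
  fixes u :: complex
  assumes "norm u = 1"
  shows "distr lborel borel ((*) u) = (lborel :: complex measure)"
proof (rule lborel_eqI[symmetric])
  fix l h :: complex
  assume le: "\<And>b. b \<in> Basis \<Longrightarrow> l \<bullet> b \<le> h \<bullet> b"
  define T where "T v = vec_of_complex (cnj u * complex_of_vec v)" for v
  have uu: "cnj u * u = 1" "u * cnj u = 1"
    using complex_norm_square[of u] assms by (auto simp: mult.commute)
  have "T 0 = 0"
    by (simp add: T_def vec_of_complex_def complex_of_vec_def vec_eq_iff forall_2 flip: zero_complex.code)
  moreover have "dist (T x) (T y) = dist x y" for x y
  proof -
    have "T x - T y = vec_of_complex (cnj u * complex_of_vec (x - y))"
      by (simp add: T_def vec_of_complex_def complex_of_vec_def vec_eq_iff forall_2 algebra_simps)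
    then show ?thesis
      by (simp add: dist_norm norm_vec_of_complex norm_complex_of_vec norm_mult assms)
  qed
  ultimately have T: "orthogonal_transformation T"
    by (simp add: orthogonal_transformation_isometry)
  define S where "S = complex_of_vec -` box l h"
  have "S \<in> sets borel"
    unfolding S_def using measurable_sets_borel[OF measurable_complex_of_vec, of "box l h"] by simp
  have emS: "emeasure lborel S = emeasure lborel (box l h)"
    unfolding S_def using arg_cong[OF lborel_complex_eq_distr, of "\<lambda>M. emeasure M (box l h)"]
    by (simp add: emeasure_distr)
  have S: "S \<in> lmeasurable"
    using \<open>S \<in> sets borel\<close> emS emeasure_lborel_box_finite[of l h]
    by (intro fmeasurableI) (auto simp: emeasure_completion)
  have TS: "complex_of_vec -` ((*) u -` box l h) = T ` S"
  proof -
    have "T (vec_of_complex (u * complex_of_vec v)) = v" for v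
      by (simp add: T_def uu flip: mult.assoc)
    moreover have "u * complex_of_vec (T v) = complex_of_vec v" for v
      by (simp add: T_def uu flip: mult.assoc)
    ultimately show ?thesis
      unfolding S_def by (auto intro!: image_eqI[where x = "vec_of_complex (u * complex_of_vec _)"])
  qed
  have pre: "(*) u -` box l h \<in> sets borel"
    using measurable_sets_borel[of "(*) u" borel "box l h"] by simp
  have TSb: "T ` S \<in> sets borel"
    using measurable_sets_borel[OF measurable_complex_of_vec, of "(*) u -` box l h"] pre TS by simp
  have "emeasure (distr lborel borel ((*) u)) (box l h) = emeasure lborel ((*) u -` box l h)"
    by (simp add: emeasure_distr)
  also have "\<dots> = emeasure lborel (T ` S)"
    using pre by (subst lborel_complex_eq_distr) (simp add: emeasure_distr TS)
  also have "\<dots> = emeasure lebesgue (T ` S)"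
    using TSb by simp
  also have "\<dots> = emeasure lebesgue S"
    using S T measure_orthogonal_image[OF T S] measurable_orthogonal_image[OF T S]
    by (simp add: emeasure_eq_measure2)
  also have "\<dots> = emeasure lborel (box l h)"
    using \<open>S \<in> sets borel\<close> emS by simp
  finally show "emeasure (distr lborel borel ((*) u)) (box l h) = ennreal (prod ((\<bullet>) (h - l)) Basis)"
    using le by (simp add: emeasure_lborel_box)
qed simp

section \<open>Normalized area measure on the disc\<close>

lemma sets_area_measure: "sets area_measure = sets (lebesgue_on unit_disc)"
  and space_area_measure [simp]: "space area_measure = unit_disc"
  by (simp_all add: area_measure_def)

lemma emeasure_lebesgue_unit_disc: "emeasure (lebesgue_on unit_disc) unit_disc = ennreal pi"
proof -
  have "emeasure lborel (unit_disc) = ennreal pi"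
    using emeasure_ball[of 1 "0::complex"] by (simp add: unit_ball_vol_2)
  then show ?thesis
    by (subst emeasure_restrict_space) auto
qed

lemma area_measure_eq_density:
  "area_measure = density (lebesgue_on unit_disc) (\<lambda>_. ennreal (1 / pi))"
  unfolding area_measure_def uniform_measure_def emeasure_lebesgue_unit_disc
proof (rule density_cong)
  have [measurable]: "unit_disc \<in> sets (lebesgue_on unit_disc)"
    by (auto simp: sets_restrict_space_iff)
  show "(\<lambda>x. indicator unit_disc x / ennreal pi) \<in> borel_measurable (lebesgue_on unit_disc)"
    by measurable
qed (auto simp: divide_ennreal simp flip: ennreal_1)

lemma finite_measure_area_measure: "finite_measure area_measure"
proof
  have "emeasure area_measure unit_disc = 1"
    unfolding area_measure_def
    by (rule emeasure_uniform_measure_1) (simp_all add: emeasure_lebesgue_unit_disc)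
  then show "emeasure area_measure (space area_measure) \<noteq> \<infinity>"
    by simp
qed

lemma borel_measurable_area_measure:
  "f \<in> borel_measurable borel \<Longrightarrow> f \<in> borel_measurable area_measure"
  unfolding measurable_cong_sets[OF sets_area_measure refl]
  by (intro measurable_restrict_space1 measurable_completion) simp

lemma sets_area_measureI:
  assumes "A \<in> sets borel" "A \<subseteq> unit_disc"
  shows "A \<in> sets area_measure"
  using assms unfolding sets_area_measure
  by (auto simp: sets_restrict_space_iff)

lemma borel_unit_disc [measurable]: "unit_disc \<in> sets borel"
  by simp

lemma borel_measurable_cnj [measurable]: "cnj \<in> borel_measurable borel"
  by (intro borel_measurable_continuous_onI continuous_intros)

text \<open>Passing from Lebesgue to Borel sets gives access to the change of variables for image measures
  of \<^const>\<open>lborel\<close>.\<close>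

lemma integral_area_measure:
  fixes f :: "complex \<Rightarrow> complex"
  assumes [measurable]: "f \<in> borel_measurable borel"
  shows "(\<integral>z. f z \<partial>area_measure) = (\<integral>z. (indicator unit_disc z / pi) *\<^sub>R f z \<partial>lborel)"
proof -
  have f: "f \<in> borel_measurable (lebesgue_on unit_disc)"
    using borel_measurable_area_measure[OF assms]
    unfolding measurable_cong_sets[OF sets_area_measure refl] .
  have "(\<integral>z. f z \<partial>area_measure) = (\<integral>z. (1 / pi) *\<^sub>R f z \<partial>lebesgue_on unit_disc)"
    unfolding area_measure_eq_density by (rule integral_density[OF f]) auto
  also have "\<dots> = (\<integral>z. indicator unit_disc z *\<^sub>R ((1 / pi) *\<^sub>R f z) \<partial>lebesgue)"
    by (rule integral_restrict_space) simp
  also have "\<dots> = (\<integral>z. (indicator unit_disc z / pi) *\<^sub>R f z \<partial>lebesgue)"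
    by simp
  also have "\<dots> = (\<integral>z. (indicator unit_disc z / pi) *\<^sub>R f z \<partial>lborel)"
    by (rule integral_completion) simp
  finally show ?thesis .
qed

lemma integral_area_measure_rotation:
  fixes f :: "complex \<Rightarrow> complex"
  assumes [measurable]: "f \<in> borel_measurable borel" and u: "norm u = 1"
  shows "(\<integral>z. f (u * z) \<partial>area_measure) = (\<integral>z. f z \<partial>area_measure)"
proof -
  have "(\<integral>z. f z \<partial>area_measure)
      = (\<integral>z. (indicator unit_disc z / pi) *\<^sub>R f z \<partial>distr lborel borel ((*) u))"
    by (simp add: integral_area_measure distr_lborel_rotation[OF u])
  also have "\<dots> = (\<integral>z. (indicator unit_disc (u * z) / pi) *\<^sub>R f (u * z) \<partial>lborel)"
    by (rule integral_distr) auto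
  also have "\<dots> = (\<integral>z. (indicator unit_disc z / pi) *\<^sub>R f (u * z) \<partial>lborel)"
    by (simp add: indicator_def norm_mult u)
  finally show ?thesis
    by (simp add: integral_area_measure)
qed

section \<open>Annuli touching the unit circle and orthogonality of monomials\<close>

definition annulus :: "real \<Rightarrow> complex set"
  where "annulus r = {w. r < norm w \<and> norm w < 1}"

lemma annulus_eq: "annulus r = ball 0 1 - cball 0 r"
  by (auto simp: annulus_def)

lemma borel_annulus [measurable]: "annulus r \<in> sets borel"
  by (simp add: annulus_eq)

lemma sets_annulus: "annulus r \<in> sets area_measure"
  by (rule sets_area_measureI) (auto simp: annulus_def)

lemma measure_annulus:
  assumes "0 \<le> r" "r < 1"
  shows "measure area_measure (annulus r) = 1 - r\<^sup>2"
proof -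
  have "measure area_measure (annulus r)
      = measure (lebesgue_on unit_disc) (annulus r) / pi"
  proof -
    have A: "annulus r \<in> sets (lebesgue_on unit_disc)"
      using sets_annulus by (simp add: sets_area_measure)
    have "unit_disc \<inter> annulus r = annulus r"
      by (auto simp: annulus_def)
    moreover have "measure (lebesgue_on unit_disc) unit_disc = pi"
      by (simp add: measure_def emeasure_lebesgue_unit_disc)
    ultimately show ?thesis
      unfolding area_measure_def
      using A by (subst measure_uniform_measure) (auto simp: emeasure_lebesgue_unit_disc)
  qed
  also have "measure (lebesgue_on unit_disc) (annulus r) = measure lborel (annulus r)"
    by (subst measure_restrict_space) (auto simp: annulus_def annulus_eq[symmetric])
  also have "\<dots> = measure lborel (ball (0::complex) 1) - measure lborel (cball (0::complex) r)"
    unfolding annulus_eq using assms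
    by (intro measure_Diff) (auto simp: emeasure_cball emeasure_ball)
  also have "\<dots> = pi - pi * r\<^sup>2"
    using assms by (simp add: content_ball content_cball unit_ball_vol_2)
  finally show ?thesis
    by (simp add: diff_divide_distrib)
qed

text \<open>Rotating by \<open>u\<close> multiplies the integral by \<open>u ^ n * cnj u ^ k\<close>, which differs from 1 for a
  suitable \<open>u\<close>.\<close>

lemma integral_annulus_monomial_eq_0:
  assumes "k \<noteq> n"
  shows "(\<integral>w. indicator (annulus r) w *\<^sub>R (w ^ n * cnj w ^ k) \<partial>area_measure) = 0" (is "?I = 0")
proof -
  \<comment> \<open>The angle is such that the factor becomes \<open>cis 1\<close>, also for \<open>n < k\<close>.\<close>
  define u where "u = cis (1 / (real n - real k))"
  have nu: "norm u = 1"
    by (simp add: u_def)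
  have "?I = (\<integral>w. indicator (annulus r) (u * w) *\<^sub>R ((u * w) ^ n * cnj (u * w) ^ k) \<partial>area_measure)"
    by (rule integral_area_measure_rotation[symmetric, OF _ nu]) measurable
  also have "\<dots> = (\<integral>w. (u ^ n * cnj u ^ k) * (indicator (annulus r) w *\<^sub>R (w ^ n * cnj w ^ k)) \<partial>area_measure)"
    by (intro Bochner_Integration.integral_cong refl)
      (simp add: annulus_def indicator_def norm_mult nu power_mult_distrib)
  also have "\<dots> = (u ^ n * cnj u ^ k) * ?I"
    by (simp only: integral_mult_right_zero)
  also have "u ^ n * cnj u ^ k = cis 1"
  proof -
    have "real n * (1 / (real n - real k)) - real k * (1 / (real n - real k)) = 1"
      using assms by (simp flip: diff_divide_distrib)
    then show ?thesis
      unfolding u_def cis_cnj Complex.DeMoivre cis_mult by simp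
  qed
  finally have "(1 - cis 1) * ?I = 0"
    by (simp add: algebra_simps)
  moreover have "cis 1 \<noteq> 1"
    using sin_gt_zero[of 1] pi_gt3 by (auto simp: complex_eq_iff)
  ultimately show ?thesis
    by simp
qed

lemma norm_annulus_monomial_le_1:
  "norm (indicator (annulus r) w *\<^sub>R (w ^ n * cnj w ^ k)) \<le> 1"
  by (auto simp: indicator_def annulus_def norm_mult norm_power intro!: mult_le_one power_le_one)

lemma integrable_annulus_monomial:
  "integrable area_measure (\<lambda>w. indicator (annulus r) w *\<^sub>R (w ^ n * cnj w ^ k))"
proof (rule finite_measure.integrable_const_bound[OF finite_measure_area_measure])
  show "AE w in area_measure. norm (indicator (annulus r) w *\<^sub>R (w ^ n * cnj w ^ k)) \<le> 1"
    by (simp only: norm_annulus_monomial_le_1 eventually_True)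
qed (intro borel_measurable_area_measure, measurable)

lemma integral_annulus_monomial_ge:
  assumes "0 \<le> r" "r < 1"
  shows "r ^ (2 * n) * (1 - r\<^sup>2)
    \<le> norm (\<integral>w. indicator (annulus r) w *\<^sub>R (w ^ n * cnj w ^ n) \<partial>area_measure)"
proof -
  define F where "F w = indicator (annulus r) w * norm w ^ (2 * n)" for w :: complex
  have "w ^ n * cnj w ^ n = complex_of_real (norm w ^ (2 * n))" for w
    by (simp only: power_mult of_real_power[of "(norm w)\<^sup>2" n] complex_norm_square power_mult_distrib)
  then have eq: "indicator (annulus r) w *\<^sub>R (w ^ n * cnj w ^ n) = complex_of_real (F w)" for w
    by (simp add: F_def scaleR_conv_of_real)
  have F: "integrable area_measure F"
    using integrable_annulus_monomial[of r n n] unfolding eq complex_of_real_integrable_eq .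
  have fin: "emeasure area_measure (annulus r) < \<infinity>"
    using finite_measure.emeasure_finite[OF finite_measure_area_measure, of "annulus r"]
    by (simp add: top.not_eq_extremum)
  have "r ^ (2 * n) * (1 - r\<^sup>2) = (\<integral>w. indicator (annulus r) w * r ^ (2 * n) \<partial>area_measure)"
    using assms sets_annulus sets.sets_into_space[OF sets_annulus]
    by (simp add: measure_annulus Int_absorb2)
  also have "\<dots> \<le> (\<integral>w. F w \<partial>area_measure)"
  proof (rule integral_mono[OF _ F])
    show "integrable area_measure (\<lambda>w. indicator (annulus r) w * r ^ (2 * n))"
      using sets_annulus fin by (intro integrable_mult_left integrable_real_indicator)
    show "indicator (annulus r) w * r ^ (2 * n) \<le> F w" for w
      using assms by (auto simp: F_def indicator_def annulus_def intro!: power_mono)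
  qed
  also have "\<dots> \<le> norm (\<integral>w. complex_of_real (F w) \<partial>area_measure)"
    by simp
  finally show ?thesis
    by (simp add: eq)
qed

section \<open>The operator on monomials cut off to an annulus\<close>

text \<open>The binomial series of the kernel pairs \<open>w ^ n\<close> with the powers \<open>cnj w ^ k\<close>, and by
  orthogonality only the term \<open>k = n\<close> survives. For fixed \<open>z\<close> in the disc the series converges
  absolutely, uniformly in \<open>w\<close>, so it may be integrated termwise.\<close>

lemma bergman_op_annulus_monomial:
  assumes z: "z \<in> unit_disc"
  shows "bergman_op \<alpha> (\<lambda>w. indicator (annulus r) w *\<^sub>R w ^ n) z
    = ((- complex_of_real \<alpha>) gchoose n) * (- z) ^ n *
      (\<integral>w. indicator (annulus r) w *\<^sub>R (w ^ n * cnj w ^ n) \<partial>area_measure)"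
proof -
  define a where "a k = ((- complex_of_real \<alpha>) gchoose k) * (- z) ^ k" for k
  define \<phi> where "\<phi> k w = indicator (annulus r) w *\<^sub>R (w ^ n * cnj w ^ k)" for k :: nat and w :: complex
  have norm_\<phi>: "norm (\<phi> k w) \<le> 1" for k w
    unfolding \<phi>_def by (rule norm_annulus_monomial_le_1)
  have int_\<phi>: "integrable area_measure (\<phi> k)" for k
    unfolding \<phi>_def by (rule integrable_annulus_monomial)
  have "ereal (norm (- z)) < conv_radius (\<lambda>k. (- complex_of_real \<alpha>) gchoose k)"
    using z by (auto simp: conv_radius_gchoose)
  then have a: "summable (\<lambda>k. norm (a k))"
    unfolding a_def by (rule abs_summable_in_conv_radius)
  have series: "(\<lambda>k. a k * \<phi> k w) sums
      (indicator (annulus r) w *\<^sub>R w ^ n / (1 - z * cnj w) powr complex_of_real \<alpha>)"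
    if w: "w \<in> unit_disc" for w
  proof -
    have "norm (z * cnj w) < 1"
      using z w mult_strict_mono[of "norm z" 1 "norm w" 1] by (auto simp: norm_mult)
    then have "norm (- (z * cnj w)) < 1"
      by simp
    from gen_binomial_complex[OF this, of "- complex_of_real \<alpha>"]
    have "(\<lambda>k. (indicator (annulus r) w *\<^sub>R w ^ n) * (((- complex_of_real \<alpha>) gchoose k) * (- (z * cnj w)) ^ k))
      sums ((indicator (annulus r) w *\<^sub>R w ^ n) * (1 + - (z * cnj w)) powr (- complex_of_real \<alpha>))"
      by (rule sums_mult)
    moreover have "(- (z * cnj w)) ^ k = (- z) ^ k * cnj w ^ k" for k
      by (metis mult_minus_left power_mult_distrib)
    ultimately show ?thesis
      by (simp add: a_def \<phi>_def mult_ac powr_minus_divide)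
  qed
  have "(\<lambda>k. \<integral>w. a k * \<phi> k w \<partial>area_measure) sums (\<integral>w. (\<Sum>k. a k * \<phi> k w) \<partial>area_measure)"
  proof (rule sums_integral)
    show "integrable area_measure (\<lambda>w. a k * \<phi> k w)" for k
      using int_\<phi> by simp
    have le: "norm (a k * \<phi> k w) \<le> norm (a k)" for k w
      using mult_left_mono[OF norm_\<phi>[of k w], of "norm (a k)"] by (simp add: norm_mult)
    show "AE w in area_measure. summable (\<lambda>k. norm (a k * \<phi> k w))"
      using le by (auto intro!: AE_I2 summable_comparison_test[OF _ a] exI[of _ 0])
    have "(\<integral>w. norm (a k * \<phi> k w) \<partial>area_measure) \<le> (\<integral>w. norm (a k) \<partial>area_measure)" for k
      using int_\<phi> le finite_measure.integrable_const[OF finite_measure_area_measure]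
      by (intro integral_mono) auto
    then have "norm (\<integral>w. norm (a k * \<phi> k w) \<partial>area_measure)
        \<le> measure area_measure unit_disc * norm (a k)" for k
      by simp
    then show "summable (\<lambda>k. \<integral>w. norm (a k * \<phi> k w) \<partial>area_measure)"
      by (intro summable_comparison_test[OF _ summable_mult[OF a]] exI[of _ 0]) blast
  qed
  also have "(\<integral>w. (\<Sum>k. a k * \<phi> k w) \<partial>area_measure) = bergman_op \<alpha> (\<lambda>w. indicator (annulus r) w *\<^sub>R w ^ n) z"
    unfolding bergman_op_def
    by (intro Bochner_Integration.integral_cong refl sums_unique[symmetric] series) simp
  also have "(\<lambda>k. \<integral>w. a k * \<phi> k w \<partial>area_measure)
      = (\<lambda>k. if k = n then a n * (\<integral>w. \<phi> n w \<partial>area_measure) else 0)"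
    unfolding \<phi>_def integral_mult_right_zero
    by (auto simp: integral_annulus_monomial_eq_0)
  finally show ?thesis
    using sums_single[of n "\<lambda>k. a n * (\<integral>w. \<phi> n w \<partial>area_measure)"]
    by (auto simp: a_def \<phi>_def dest: sums_unique2)
qed

section \<open>Comparing norms with powers of the measure of a set\<close>

lemma Lp_norm_le_measure_powr:
  assumes p: "1 \<le> p" and f: "f \<in> borel_measurable area_measure" and A: "A \<in> sets area_measure"
    and le: "\<And>z. norm (f z) \<le> indicator A z" and pos: "0 < measure area_measure A"
  shows "Lp_norm p f \<le> ennreal (measure area_measure A powr real_of_ereal (1 / p))"
proof (cases p)
  case PInf
  have "norm (f z) \<le> 1" for z
    using order_trans[OF le[of z]] by (simp add: indicator_def)
  then have "esssup area_measure (\<lambda>z. ennreal (norm (f z))) \<le> 1"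
    using f by (intro esssup_I) auto
  then show ?thesis
    using PInf pos by (simp add: Lp_norm_def)
next
  case (real x)
  with p have x: "1 \<le> x"
    by simp
  define I where "I = (\<integral>\<^sup>+ z. ennreal (norm (f z) powr x) \<partial>area_measure)"
  have "I \<le> (\<integral>\<^sup>+ z. indicator A z \<partial>area_measure)"
    unfolding I_def
  proof (rule nn_integral_mono)
    fix z
    show "ennreal (norm (f z) powr x) \<le> indicator A z"
      using le[of z] x by (auto simp: indicator_def powr_le1 split: if_splits)
  qed
  then have I: "I \<le> ennreal (measure area_measure A)"
    using A finite_measure.emeasure_eq_measure[OF finite_measure_area_measure] by simp
  then have "enn2real I \<le> measure area_measure A" "I \<noteq> \<infinity>"
    by (auto simp: enn2real_leI top_unique)
  moreover have "1 / p = ereal (1 / x)"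
    using real x by (simp add: one_ereal_def)
  ultimately show ?thesis
    using real x by (auto simp: Lp_norm_def Let_def I_def[symmetric] intro!: ennreal_leI powr_mono2)
qed (use p in simp)

text \<open>Measurability of \<open>g\<close> matters when \<open>q\<close> is finite: without it the distribution function could be
  evaluated on a nonmeasurable set, where \<^const>\<open>measure\<close> is 0 by convention.\<close>

lemma weak_Lp_norm_ge_measure_powr:
  assumes q: "1 \<le> q" and g: "g \<in> borel_measurable area_measure" and A: "A \<in> sets area_measure"
    and s: "0 < s" "\<And>z. z \<in> A \<Longrightarrow> s < norm (g z)" and pos: "0 < measure area_measure A"
  shows "ennreal (s * measure area_measure A powr real_of_ereal (1 / q)) \<le> weak_Lp_norm q g"
proof -
  have A_disc: "A \<subseteq> unit_disc"
    using sets.sets_into_space[OF A] by simp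
  show ?thesis
  proof (cases q)
    case PInf
    define S where "S = esssup area_measure (\<lambda>z. ennreal (norm (g z)))"
    have "ennreal s \<le> S"
    proof (rule ccontr)
      assume *: "\<not> ennreal s \<le> S"
      let ?B = "{z \<in> space area_measure. ennreal (norm (g z)) > S}"
      have "S < ennreal (norm (g z))" if "z \<in> A" for z
      proof -
        have "S < ennreal s"
          using * by simp
        also have "\<dots> \<le> ennreal (norm (g z))"
          using s(2)[OF that] by (intro ennreal_leI) simp
        finally show ?thesis .
      qed
      then have "A \<subseteq> ?B"
        using A_disc by auto
      then have "emeasure area_measure A \<le> emeasure area_measure ?B"
      proof (rule emeasure_mono)
        note g[measurable]
        show "?B \<in> sets area_measure"
          by measurable
      qed
      also have "emeasure area_measure ?B = 0"
        unfolding S_def by (rule esssup_zero_measure)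
      finally show False
        using pos by (simp add: measure_def)
    qed
    then show ?thesis
      using PInf pos by (simp add: weak_Lp_norm_def Lp_norm_def S_def)
  next
    case (real y)
    with q have y: "1 \<le> y"
      by simp
    let ?B = "{z \<in> unit_disc. norm (g z) > s}"
    note g[measurable]
    have "{z \<in> space area_measure. norm (g z) > s} \<in> sets area_measure"
      by measurable
    then have "?B \<in> sets area_measure"
      by (simp only: space_area_measure)
    then have "measure area_measure A \<le> measure area_measure ?B"
      using s A_disc by (intro finite_measure.finite_measure_mono[OF finite_measure_area_measure]) auto
    moreover have "1 / q = ereal (1 / y)"
      using real y by (simp add: one_ereal_def)
    ultimately show ?thesis
      using real y s unfolding weak_Lp_norm_def
      by (auto intro!: SUP_upper2[of s] ennreal_leI mult_left_mono powr_mono2)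
  qed (use q in simp)
qed

section \<open>Growth of the coefficients against a bound for the operator\<close>

lemma norm_gbinomial_asymptotic:
  assumes "0 < \<alpha>"
  shows "\<exists>c>0. (\<lambda>n. norm ((- complex_of_real \<alpha>) gchoose n) * real n powr (1 - \<alpha>)) \<longlonglongrightarrow> c"
proof (intro exI conjI)
  have "complex_of_real \<alpha> \<notin> \<int>\<^sub>\<le>\<^sub>0"
    using assms by (auto simp: nonpos_Ints_def complex_eq_iff)
  then show "0 < norm (inverse (Gamma (complex_of_real \<alpha>)))"
    by (simp add: Gamma_eq_zero_iff)
  have "(\<lambda>n. norm (((- complex_of_real \<alpha>) gchoose n)
      / ((- 1) ^ n / exp ((- complex_of_real \<alpha> + 1) * of_real (ln (real n))))))
      \<longlonglongrightarrow> norm (inverse (Gamma (- (- complex_of_real \<alpha>))))"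
    by (rule tendsto_norm[OF gbinomial_asymptotic])
  moreover have "eventually (\<lambda>n. norm (((- complex_of_real \<alpha>) gchoose n)
      / ((- 1) ^ n / exp ((- complex_of_real \<alpha> + 1) * of_real (ln (real n)))))
      = norm ((- complex_of_real \<alpha>) gchoose n) * real n powr (1 - \<alpha>)) sequentially"
    using eventually_gt_at_top[of 0]
    by eventually_elim (simp add: norm_divide norm_mult norm_power powr_def)
  ultimately show "(\<lambda>n. norm ((- complex_of_real \<alpha>) gchoose n) * real n powr (1 - \<alpha>))
      \<longlonglongrightarrow> norm (inverse (Gamma (complex_of_real \<alpha>)))"
    by (auto intro: Lim_transform_eventually)
qed

text \<open>This is what boundedness says about the single test function \<open>w ^ n\<close> on an annulus of measure
  \<open>m = 1 / (2 * n)\<close>: its \<open>L\<^sup>p\<close> norm is at most \<open>m powr (1 / p)\<close>, while on that same annulus its image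
  has modulus at least a constant times \<open>m\<close> times the \<open>n\<close>-th coefficient of the kernel.\<close>

lemma norm_gbinomial_le_of_bounded:
  assumes p: "1 \<le> p" and q: "1 \<le> q" and n: "0 < n"
    and C: "\<forall>f\<in>Lp p. weak_Lp_norm q (bergman_op \<alpha> f) \<le> ennreal C * Lp_norm p f"
  shows "norm ((- complex_of_real \<alpha>) gchoose n)
    \<le> 8 * max C 0 * (2 * real n) powr (1 + real_of_ereal (1 / q) - real_of_ereal (1 / p))"
    (is "?a \<le> _ * _ powr (1 + ?Q - ?P)")
proof -
  define m where "m = 1 / (2 * real n)"
  define r where "r = sqrt (1 - m)"
  have m: "0 < m" "m \<le> 1 / 2"
    using n by (auto simp: m_def field_simps)
  have r: "0 \<le> r" "r < 1" and r2: "r\<^sup>2 = 1 - m"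
    using m by (auto simp: r_def)
  have meas: "measure area_measure (annulus r) = m"
    using measure_annulus[OF r] r2 by simp
  \<comment> \<open>The annulus has width of order \<open>1 / n\<close>, so that \<open>n\<close>-th powers stay bounded below on it.\<close>
  have half: "1 / 2 \<le> r ^ (2 * n)"
  proof -
    have "1 / 2 = 1 + real n * (- m)"
      using n by (simp add: m_def)
    also have "\<dots> \<le> (1 + (- m)) ^ n"
      using m by (intro Bernoulli_inequality) simp
    finally show ?thesis
      by (simp add: power_mult r2)
  qed
  define f where "f w = indicator (annulus r) w *\<^sub>R w ^ n" for w :: complex
  define J where "J = (\<integral>w. indicator (annulus r) w *\<^sub>R (w ^ n * cnj w ^ n) \<partial>area_measure)"
  have Kf: "bergman_op \<alpha> f z = ((- complex_of_real \<alpha>) gchoose n) * (- z) ^ n * J" if "z \<in> unit_disc" for z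
    unfolding f_def J_def using that by (rule bergman_op_annulus_monomial)
  have f_meas: "f \<in> borel_measurable area_measure"
    unfolding f_def by (intro borel_measurable_area_measure) measurable
  have Kf_meas: "bergman_op \<alpha> f \<in> borel_measurable area_measure"
    by (subst measurable_cong[OF Kf]) (auto intro!: borel_measurable_area_measure)
  have f_norm: "Lp_norm p f \<le> ennreal (m powr ?P)"
  proof -
    have "norm (f z) \<le> indicator (annulus r) z" for z
      by (auto simp: f_def indicator_def annulus_def norm_power intro!: power_le_one)
    from Lp_norm_le_measure_powr[OF p f_meas sets_annulus this] show ?thesis
      using m by (simp add: meas)
  qed
  then have "f \<in> Lp p"
    using f_meas by (auto simp: Lp_def intro: le_less_trans)
  have J: "m / 2 \<le> norm J"
  proof -
    have "1 / 2 * m \<le> r ^ (2 * n) * m"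
      using half m by (intro mult_right_mono) auto
    also have "\<dots> = r ^ (2 * n) * (1 - r\<^sup>2)"
      by (simp add: r2)
    also have "\<dots> \<le> norm J"
      unfolding J_def by (rule integral_annulus_monomial_ge[OF r])
    finally show ?thesis
      by simp
  qed
  have Kf_ge: "?a * m / 4 \<le> norm (bergman_op \<alpha> f z)" if z: "z \<in> annulus r" for z
  proof -
    have "r ^ (2 * n) \<le> r ^ n"
      using r by (intro power_decreasing) auto
    also have "r ^ n \<le> norm z ^ n"
      using z r by (intro power_mono) (auto simp: annulus_def)
    finally have "1 / 2 * (m / 2) \<le> norm z ^ n * norm J"
      using half J m by (intro mult_mono) auto
    from mult_left_mono[OF this, of ?a] show ?thesis
      using z by (simp add: Kf annulus_def norm_mult norm_power mult_ac)
  qed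
  \<comment> \<open>The level is half of the lower bound \<open>?a * m / 4\<close>, because the distribution function counts
    strict inequality only.\<close>
  have "?a * m / 8 * m powr ?Q \<le> max C 0 * m powr ?P"
  proof (cases "?a = 0")
    case False
    then have s: "0 < ?a * m / 8" "?a * m / 8 < ?a * m / 4"
      using m by auto
    have "?a * m / 8 < norm (bergman_op \<alpha> f z)" if "z \<in> annulus r" for z
      using s(2) Kf_ge[OF that] by (rule less_le_trans)
    then have "ennreal (?a * m / 8 * m powr ?Q) \<le> weak_Lp_norm q (bergman_op \<alpha> f)"
      using weak_Lp_norm_ge_measure_powr[OF q Kf_meas sets_annulus s(1), of r, unfolded meas] m by blast
    also have "\<dots> \<le> ennreal C * Lp_norm p f"
      using C \<open>f \<in> Lp p\<close> by blast
    \<comment> \<open>\<open>C\<close> may be negative, in which case \<open>ennreal C\<close> is 0.\<close>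
    also have "\<dots> \<le> ennreal (max C 0) * ennreal (m powr ?P)"
      by (intro mult_mono f_norm ennreal_leI) auto
    also have "\<dots> = ennreal (max C 0 * m powr ?P)"
      by (simp add: ennreal_mult)
    finally show ?thesis
      by (subst (asm) ennreal_le_iff) auto
  qed simp
  then have "?a * m powr (1 + ?Q) \<le> 8 * max C 0 * m powr ?P"
    using m by (simp add: powr_add mult_ac)
  then have "?a \<le> 8 * max C 0 * (m powr ?P / m powr (1 + ?Q))"
    using m by (simp add: field_simps)
  also have "m powr ?P / m powr (1 + ?Q) = m powr (- (1 + ?Q - ?P))"
    by (simp add: powr_diff[symmetric])
  also have "m = (2 * real n) powr (- 1)"
    using n by (simp add: m_def powr_minus_divide)
  also have "\<dots> powr (- (1 + ?Q - ?P)) = (2 * real n) powr (1 + ?Q - ?P)"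
    unfolding powr_powr by simp
  finally show ?thesis .
qed

theorem proposition4p2:
  fixes t :: real and p q :: ereal
  assumes "1 < t" and "t < 3 / 2"
    and "1 \<le> p" and "1 \<le> q"
    and "1 / q - 1 / p < ereal (2 * t - 2)"
  shows "\<not> bounded_Lp_weak_Lq p q (bergman_op (2 * t))"
proof
  assume "bounded_Lp_weak_Lq p q (bergman_op (2 * t))"
  then obtain C where C: "\<forall>f\<in>Lp p. weak_Lp_norm q (bergman_op (2 * t) f) \<le> ennreal C * Lp_norm p f"
    unfolding bounded_Lp_weak_Lq_def by blast
  define e where "e = 1 + real_of_ereal (1 / q) - real_of_ereal (1 / p)"
  have fin: "\<exists>y. 1 / x = ereal y" if "1 \<le> x" for x :: ereal
    using that by (cases x) (auto simp: one_ereal_def zero_ereal_def)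
  obtain Q P where "1 / q = ereal Q" "1 / p = ereal P"
    using fin assms by meson
  with assms(5) have e: "e + (1 - 2 * t) < 0"
    by (simp add: e_def)
  obtain c where c: "0 < c"
    and lim: "(\<lambda>n. norm ((- complex_of_real (2 * t)) gchoose n) * real n powr (1 - 2 * t)) \<longlonglongrightarrow> c"
    using norm_gbinomial_asymptotic[of "2 * t"] assms(1) by auto
  \<comment> \<open>Boundedness makes the normalized coefficients \<open>O(n powr (e + 1 - 2 * t))\<close>, which forces \<open>c \<le> 0\<close>.\<close>
  have "(\<lambda>n. 8 * max C 0 * 2 powr e * real n powr (e + (1 - 2 * t))) \<longlonglongrightarrow> 8 * max C 0 * 2 powr e * 0"
    by (intro tendsto_mult tendsto_const tendsto_neg_powr[OF e] filterlim_real_sequentially)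
  moreover have "eventually (\<lambda>n. norm ((- complex_of_real (2 * t)) gchoose n) * real n powr (1 - 2 * t)
      \<le> 8 * max C 0 * 2 powr e * real n powr (e + (1 - 2 * t))) sequentially"
    using eventually_gt_at_top[of 0]
  proof eventually_elim
    case (elim n)
    have "norm ((- complex_of_real (2 * t)) gchoose n) * real n powr (1 - 2 * t)
        \<le> (8 * max C 0 * (2 * real n) powr e) * real n powr (1 - 2 * t)"
      unfolding e_def by (intro mult_right_mono norm_gbinomial_le_of_bounded[OF assms(3,4) elim C]) simp
    then show ?case
      by (simp add: powr_mult powr_add mult_ac)
  qed
  ultimately have "c \<le> 8 * max C 0 * 2 powr e * 0"
    using lim by (intro tendsto_le[OF sequentially_bot])
  with c show False
    by simp
qed

end
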